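(* Let $n\ge 3$ and let $F$ be a field. For all $1\le i,j\le n$, the reduced companion matrices $P_i,P_j\in M_{c_n-1}(F)$ of the ideal $I_n$ commute, that is, $[P_i,P_j]=P_iP_j-P_jP_i=0$.
   Context: $I_n\subset R_n=F[x_1,\dots,x_n]$ is the ideal generated by the $n$ binomials $\prod_{j\ne i}x_j-x_i$, $1\le i\le n$. Put $c_n=1+(n-2)2^{n-1}$, which is $\dim_F R_n/I_n$. Fix the lexicographic order with $x_1>\cdots>x_n$. The monomial basis $\mathcal B$ of $R_n/I_n$ consists of (the classes of) the monomials $m(b,T)=x_n^b\prod_{i\in T}x_i$ with $T\subseteq\{2,\dots,n-1\}$ and $0\le b<2n-4$, together with $m(2n-4,\emptyset)=x_n^{2n-4}$; it is ordered so that $1=m(0,\emptyset)$ is the first element. The companion matrix $T_i$ is the $c_n\times c_n$ matrix of the multiplication map $m_{x_i}:R_n/I_n\to R_n/I_n$, $f\mapsto x_if$, with respect to $\mathcal B$, with the convention that the $r$-th row contains the coordinates of $x_i\cdot m_r$, where $m_r$ is the $r$-th element of $\mathcal B$. The reduced companion matrix $P_i$ is obtained from $T_i$ by deleting the first row and the first column (those corresponding to $1$). *)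

theory Defs
  imports
    "HOL-Library.Poly_Mapping"
    "HOL-Algebra.QuotRing"
    "Jordan_Normal_Form.Determinant"
begin

text \<open>
  Polynomials over a field in the indeterminates \<open>x\<^sub>k\<close>, \<open>k :: nat\<close>: finitely supported functions
  from exponent vectors to coefficients, with the convolution product of the library.
\<close>

type_synonym 'a multipoly = "(nat \<Rightarrow>\<^sub>0 nat) \<Rightarrow>\<^sub>0 'a"

definition const :: "'a \<Rightarrow> 'a::field multipoly" where
  "const a = Poly_Mapping.single 0 a"

definition var :: "nat \<Rightarrow> 'a::field multipoly" where
  "var k = Poly_Mapping.single (Poly_Mapping.single k 1) 1"

text \<open>The ring \<open>R\<^sub>n = F[x\<^sub>1, \<dots>, x\<^sub>n]\<close>.\<close>

definition poly_ring :: "nat \<Rightarrow> 'a::field multipoly ring" where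
  "poly_ring n =
    \<lparr>carrier = {p. \<forall>e \<in> Poly_Mapping.keys p. Poly_Mapping.keys e \<subseteq> {1..n}},
     monoid.mult = (*), one = 1, zero = 0, add = (+)\<rparr>"

definition binom_ideal :: "nat \<Rightarrow> 'a::field multipoly set" where
  "binom_ideal n =
    genideal (poly_ring n) {(\<Prod>j\<in>{1..n} - {i}. var j) - var i | i. i \<in> {1..n}}"

definition quot_ring :: "nat \<Rightarrow> 'a::field multipoly set ring" where
  "quot_ring n = poly_ring n Quot binom_ideal n"

definition residue_class :: "nat \<Rightarrow> 'a::field multipoly \<Rightarrow> 'a multipoly set" where
  "residue_class n p = binom_ideal n +>\<^bsub>poly_ring n\<^esub> p"

text \<open>The \<open>F\<close>-vector space structure of \<open>R\<^sub>n / I\<^sub>n\<close>: scalars act through constant polynomials.\<close>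

definition scale :: "nat \<Rightarrow> 'a::field \<Rightarrow> 'a multipoly set \<Rightarrow> 'a multipoly set" where
  "scale n a q = residue_class n (const a) \<otimes>\<^bsub>quot_ring n\<^esub> q"

definition mult_map :: "nat \<Rightarrow> nat \<Rightarrow> 'a::field multipoly set \<Rightarrow> 'a multipoly set" where
  "mult_map n i q = residue_class n (var i) \<otimes>\<^bsub>quot_ring n\<^esub> q"

definition c_dim :: "nat \<Rightarrow> nat" where
  "c_dim n = 1 + (n - 2) * 2 ^ (n - 1)"

definition basis_monomial :: "nat \<Rightarrow> nat \<Rightarrow> nat set \<Rightarrow> 'a::field multipoly" where
  "basis_monomial n b T = var n ^ b * (\<Prod>k\<in>T. var k)"

definition basis_monomials :: "nat \<Rightarrow> 'a::field multipoly set" where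
  "basis_monomials n =
    {basis_monomial n b T | b T. T \<subseteq> {2..n - 1} \<and> b < 2 * n - 4}
      \<union> {basis_monomial n (2 * n - 4) {}}"

text \<open>
  The only constraint on the order of the basis is that \<open>1\<close> comes first; every such
  enumeration is admitted.
\<close>

definition basis_enumeration :: "nat \<Rightarrow> 'a::field multipoly list \<Rightarrow> bool" where
  "basis_enumeration n ms \<longleftrightarrow>
    distinct ms \<and> set ms = basis_monomials n \<and> hd ms = basis_monomial n 0 {}"

text \<open>
  Coordinates of an element of \<open>R\<^sub>n / I\<^sub>n\<close> with respect to the classes of the members of \<open>ms\<close>.
  The description is proper because these classes form a basis when \<open>ms\<close> enumerates the
  basis monomials and \<open>n \<ge> 3\<close>.
\<close>

definition coordinates ::
  "nat \<Rightarrow> 'a::field multipoly list \<Rightarrow> 'a multipoly set \<Rightarrow> 'a Matrix.vec" where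
  "coordinates n ms q =
    (THE v. v \<in> carrier_vec (c_dim n) \<and>
      q = (\<Oplus>\<^bsub>quot_ring n\<^esub> s \<in> {..<c_dim n}. scale n (v $ s) (residue_class n (ms ! s))))"

text \<open>Row convention: row \<open>r\<close> holds the coordinates of the image of the \<open>r\<close>-th basis element.\<close>

definition companion_matrix :: "nat \<Rightarrow> 'a::field multipoly list \<Rightarrow> nat \<Rightarrow> 'a Matrix.mat" where
  "companion_matrix n ms i =
    Matrix.mat (c_dim n) (c_dim n)
      (\<lambda>(r, s). coordinates n ms (mult_map n i (residue_class n (ms ! r))) $ s)"

definition reduced_companion_matrix ::
  "nat \<Rightarrow> 'a::field multipoly list \<Rightarrow> nat \<Rightarrow> 'a Matrix.mat" where
  "reduced_companion_matrix n ms i = mat_delete (companion_matrix n ms i) 0 0"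

end

theory Submission
  imports Defs "HOL-Number_Theory.Cong"
begin

text \<open>
  The ideal is generated by differences of monomials, so the quotient is the algebra of a
  commutative monoid: monomials modulo the congruence generated by
  \<open>\<Prod>\<^bsub>j\<noteq>i\<^esub> x\<^sub>j \<sim> x\<^sub>i\<close>. The basis monomials are representatives of the congruence classes. Hence
  \<open>x\<^sub>i\<close> sends every basis element to a single basis element, and the companion matrix \<open>T\<^sub>i\<close> is the
  0/1 matrix of a self-map \<open>\<phi>\<^sub>i\<close> of the index set. Both sides of a generator are different from \<open>1\<close>,
  so \<open>1\<close> is congruent to no other monomial; therefore \<open>\<phi>\<^sub>i\<close> never takes the value \<open>0\<close>, the index
  of \<open>1\<close>, and the first column of \<open>T\<^sub>i\<close> vanishes
  (lemma \<open>companion_matrix_first_column\<close>). On matrices with vanishing first column,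
  deletion of the first row and column is multiplicative
  (\<open>mat_delete_mult_first_column_zero\<close>), so the relation \<open>T\<^sub>iT\<^sub>j = T\<^sub>jT\<^sub>i\<close>, which holds because
  multiplication in the quotient is commutative, passes to the reduced matrices.

  It remains to see that each product of a variable and a basis monomial is congruent to exactly one
  basis monomial. For uniqueness, an explicit congruence invariant is given. Substituting \<open>x\<^sub>1 = x\<^sub>2\<cdots>x\<^sub>n\<close> turns a
  monomial with exponents \<open>e\<^sub>1,\<dots>,e\<^sub>n\<close> into one with exponents \<open>e\<^sub>k + e\<^sub>1\<close>, \<open>2 \<le> k \<le> n\<close>, and the other
  relations then preserve the parities for \<open>k < n\<close>, the total degree modulo \<open>2n-4\<close>, and
  whether the monomial is \<open>1\<close> (lemma \<open>signature_generator\<close>). Coefficient sums over the classes of this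
  invariant are linear functionals that vanish on the ideal
  (\<open>functional_vanishes_on_binom_ideal\<close>), and they separate the basis monomials.
  For existence, the generators imply that all \<open>x\<^sub>i\<^sup>2\<close> coincide and that
  \<open>x\<^sub>ix\<^sub>n\<^sup>2\<^sup>n\<^sup>-\<^sup>4 = x\<^sub>i\<close> for \<open>i \<ge> 2\<close>; with \<open>x\<^sub>1 = x\<^sub>2\<cdots>x\<^sub>n\<close> these reduce every product of a variable and a basis
  monomial to a basis monomial (\<open>reducible_var_mult\<close>).
\<close>

(* Otherwise simp turns the literal 1 into Suc 0, and facts about the first variable stop matching. *)
declare One_nat_def [simp del]

section \<open>The polynomial ring and its quotient\<close>

abbreviation monomial :: "(nat \<Rightarrow>\<^sub>0 nat) \<Rightarrow> 'a::field multipoly" where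
  "monomial e \<equiv> Poly_Mapping.single e 1"

lemma monomial_mult: "monomial d * monomial e = (monomial (d + e) :: 'a::field multipoly)"
  by (simp add: mult_single)

lemma var_power: "var k ^ b = (monomial (Poly_Mapping.single k b) :: 'a::field multipoly)"
  by (induction b) (simp_all add: var_def mult_single single_add[symmetric] plus_1_eq_Suc)

lemma prod_var:
  "(\<Prod>k\<in>A. var k) = (monomial (\<Sum>k\<in>A. Poly_Mapping.single k 1) :: 'a::field multipoly)"
  by (induction A rule: infinite_finite_induct) (simp_all add: var_def mult_single)

lemma keys_add_nat:
  "Poly_Mapping.keys (d + e :: 'b \<Rightarrow>\<^sub>0 nat) = Poly_Mapping.keys d \<union> Poly_Mapping.keys e"
  by (auto simp: in_keys_iff lookup_add)

lemma mem_carrier_poly_ring: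
  "p \<in> carrier (poly_ring n) \<longleftrightarrow> (\<forall>e\<in>Poly_Mapping.keys p. Poly_Mapping.keys e \<subseteq> {1..n})"
  by (simp add: poly_ring_def)

lemma poly_ring_simps [simp]:
  "monoid.mult (poly_ring n) = (*)" "one (poly_ring n) = 1"
  "zero (poly_ring n) = 0" "add (poly_ring n) = (+)"
  by (simp_all add: poly_ring_def)

lemma single_mem_carrier:
  "Poly_Mapping.keys e \<subseteq> {1..n} \<Longrightarrow> Poly_Mapping.single e c \<in> carrier (poly_ring n)"
  by (auto simp: mem_carrier_poly_ring split: if_splits)

lemma one_mem_carrier: "1 \<in> carrier (poly_ring n)"
  using single_mem_carrier[of 0 n 1] by (simp add: single_one)

lemma add_mem_carrier:
  "p \<in> carrier (poly_ring n) \<Longrightarrow> q \<in> carrier (poly_ring n) \<Longrightarrow> p + q \<in> carrier (poly_ring n)"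
  using Poly_Mapping.keys_add[of p q] unfolding mem_carrier_poly_ring by blast

lemma uminus_mem_carrier:
  "(p :: 'a::field multipoly) \<in> carrier (poly_ring n) \<Longrightarrow> - p \<in> carrier (poly_ring n)"
  by (auto simp: mem_carrier_poly_ring in_keys_iff)

lemma mult_mem_carrier:
  assumes "p \<in> carrier (poly_ring n)" "q \<in> carrier (poly_ring n)"
  shows "p * q \<in> carrier (poly_ring n)"
  unfolding mem_carrier_poly_ring
proof
  fix e assume "e \<in> Poly_Mapping.keys (p * q)"
  then obtain a b where "e = a + b" "a \<in> Poly_Mapping.keys p" "b \<in> Poly_Mapping.keys q"
    using keys_mult[of p q] by blast
  then show "Poly_Mapping.keys e \<subseteq> {1..n}"
    using assms by (auto simp: mem_carrier_poly_ring keys_add_nat)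
qed

lemma var_mem_carrier: "k \<in> {1..n} \<Longrightarrow> var k \<in> carrier (poly_ring n)"
  by (simp add: var_def single_mem_carrier)

lemma const_mem_carrier: "const c \<in> carrier (poly_ring n)"
  by (simp add: const_def single_mem_carrier)

lemma sum_single_keys:
  "finite A \<Longrightarrow> Poly_Mapping.keys (\<Sum>k\<in>A. Poly_Mapping.single k (1::nat)) = A"
  by (induction A rule: finite_induct) (simp_all add: keys_add_nat)

lemma prod_var_mem_carrier: "A \<subseteq> {1..n} \<Longrightarrow> (\<Prod>k\<in>A. var k) \<in> carrier (poly_ring n)"
  unfolding prod_var using finite_subset[of A "{1..n}"]
  by (intro single_mem_carrier) (simp add: sum_single_keys)

lemma var_power_mem_carrier: "k \<in> {1..n} \<Longrightarrow> var k ^ b \<in> carrier (poly_ring n)"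
  unfolding var_power by (intro single_mem_carrier) simp

lemma cring_poly_ring: "cring (poly_ring n :: 'a::field multipoly ring)"
proof (rule cringI)
  show "abelian_group (poly_ring n :: 'a multipoly ring)"
  proof (rule abelian_groupI)
    fix x :: "'a multipoly" assume "x \<in> carrier (poly_ring n)"
    then show "\<exists>y\<in>carrier (poly_ring n). y \<oplus>\<^bsub>poly_ring n\<^esub> x = \<zero>\<^bsub>poly_ring n\<^esub>"
      by (intro bexI[of _ "- x"]) (simp_all add: uminus_mem_carrier)
  qed (simp_all add: add_mem_carrier add_ac, simp add: mem_carrier_poly_ring)
  show "comm_monoid (poly_ring n :: 'a multipoly ring)"
    by unfold_locales (simp_all add: mult_mem_carrier one_mem_carrier mult_ac)
qed (simp add: distrib_right)

interpretation poly_ring: cring "poly_ring n :: 'a::field multipoly ring" for n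
  by (rule cring_poly_ring)

lemma finsum_poly_ring:
  "finite A \<Longrightarrow> (\<And>s. s \<in> A \<Longrightarrow> f s \<in> carrier (poly_ring n)) \<Longrightarrow>
    (\<Oplus>\<^bsub>poly_ring n\<^esub> s\<in>A. f s) = (\<Sum>s\<in>A. f s :: 'a::field multipoly)"
  by (induction A rule: finite_induct) (simp_all add: Pi_def)

lemma sum_mem_carrier:
  "finite A \<Longrightarrow> (\<And>s. s \<in> A \<Longrightarrow> f s \<in> carrier (poly_ring n)) \<Longrightarrow>
    (\<Sum>s\<in>A. f s :: 'a::field multipoly) \<in> carrier (poly_ring n)"
  by (metis finsum_poly_ring Pi_I poly_ring.finsum_closed)

lemma uminus_poly_ring:
  "q \<in> carrier (poly_ring n) \<Longrightarrow> \<ominus>\<^bsub>poly_ring n\<^esub> q = - (q :: 'a::field multipoly)"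
  by (rule poly_ring.minus_equality) (simp_all add: uminus_mem_carrier)

lemma minus_poly_ring:
  "q \<in> carrier (poly_ring n) \<Longrightarrow> p \<ominus>\<^bsub>poly_ring n\<^esub> q = p - (q :: 'a::field multipoly)"
  by (simp add: a_minus_def uminus_poly_ring)

definition generators :: "nat \<Rightarrow> 'a::field multipoly set" where
  "generators n = {(\<Prod>j\<in>{1..n} - {i}. var j) - var i | i. i \<in> {1..n}}"

lemma generators_subset: "generators n \<subseteq> carrier (poly_ring n)"
proof -
  have "(\<Prod>j\<in>{1..n} - {i}. var j) - var i \<in> carrier (poly_ring n)" if "i \<in> {1..n}" for i
    using add_mem_carrier[OF prod_var_mem_carrier[of "{1..n} - {i}"]
        uminus_mem_carrier[OF var_mem_carrier[OF that]]]
    by simp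
  then show ?thesis by (auto simp: generators_def)
qed

lemma binom_ideal_eq: "binom_ideal n = genideal (poly_ring n) (generators n)"
  by (simp add: binom_ideal_def generators_def)

lemma ideal_binom_ideal: "ideal (binom_ideal n) (poly_ring n :: 'a::field multipoly ring)"
  unfolding binom_ideal_eq by (rule poly_ring.genideal_ideal[OF generators_subset])

interpretation residue: ring_hom_cring "poly_ring n :: 'a::field multipoly ring"
    "quot_ring n" "residue_class n" for n
  using ideal.rcos_ring_hom_cring[OF ideal_binom_ideal cring_poly_ring, of n]
  by (simp add: quot_ring_def residue_class_def[abs_def])

lemma residue_class_mult:
  "p \<in> carrier (poly_ring n) \<Longrightarrow> q \<in> carrier (poly_ring n) \<Longrightarrow>
    residue_class n (p * q) = residue_class n p \<otimes>\<^bsub>quot_ring n\<^esub> residue_class n q"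
  using residue.hom_mult[of p n q] by simp

lemma residue_class_eq_iff:
  assumes "p \<in> carrier (poly_ring n)" "q \<in> carrier (poly_ring n)"
  shows "residue_class n p = residue_class n q \<longleftrightarrow> p - q \<in> binom_ideal n"
  using poly_ring.quotient_eq_iff_same_a_r_cos[OF ideal_binom_ideal assms]
  by (simp add: residue_class_def minus_poly_ring assms)

lemma residue_class_mult_cong:
  assumes "p \<in> carrier (poly_ring n)" "p' \<in> carrier (poly_ring n)" "q \<in> carrier (poly_ring n)"
    and "residue_class n p = residue_class n p'"
  shows "residue_class n (q * p) = residue_class n (q * p')"
  using assms by (simp add: residue_class_mult)

section \<open>An invariant of monomials modulo the ideal\<close>

text \<open>
  The exponent \<open>e\<^sub>k + e\<^sub>1\<close> is that of \<open>x\<^sub>k\<close> after the substitution \<open>x\<^sub>1 = x\<^sub>2\<cdots>x\<^sub>n\<close>. Its parity at \<open>k = n\<close>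
  is left out because the total degree, whose modulus is even, determines it. The first component
  separates \<open>1\<close> from \<open>x\<^sub>n\<^sup>2\<^sup>n\<^sup>-\<^sup>4\<close>, which agree in the other two.
\<close>

definition signature :: "nat \<Rightarrow> (nat \<Rightarrow>\<^sub>0 nat) \<Rightarrow> bool \<times> nat set \<times> nat" where
  "signature n e =
    (e = 0,
     {k \<in> {2..n - 1}. odd (Poly_Mapping.lookup e k + Poly_Mapping.lookup e 1)},
     (\<Sum>k\<in>{2..n}. Poly_Mapping.lookup e k + Poly_Mapping.lookup e 1) mod (2 * n - 4))"

text \<open>
  Compatibility with multiplication of monomials: parities and residues are additive, and a sum of
  exponent vectors of natural numbers is zero only if both summands are.
\<close>

lemma signature_add_cong:
  assumes "signature n e = signature n f"
  shows "signature n (d + e) = signature n (d + f)"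
proof -
  let ?w = "\<lambda>e k. Poly_Mapping.lookup e k + Poly_Mapping.lookup e (1::nat) :: nat"
  have w: "?w (d + e) k = ?w d k + ?w e k" for d e k
    by (simp add: lookup_add)
  have zero: "d + e = 0 \<longleftrightarrow> d = 0 \<and> e = 0" for d e :: "nat \<Rightarrow>\<^sub>0 nat"
    by (metis keys_add_nat keys_eq_empty Un_empty)
  have "{k \<in> {2..n - 1}. odd (?w e k)} = {k \<in> {2..n - 1}. odd (?w f k)}"
    using assms by (simp add: signature_def)
  then have "k \<in> {2..n - 1} \<Longrightarrow> odd (?w e k) \<longleftrightarrow> odd (?w f k)" for k
    by blast
  then have "odd (?w (d + e) k) \<longleftrightarrow> odd (?w (d + f) k)" if "k \<in> {2..n - 1}" for k
    unfolding w even_add[of "?w d k"] using that by blast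
  then have "{k \<in> {2..n - 1}. odd (?w (d + e) k)} = {k \<in> {2..n - 1}. odd (?w (d + f) k)}"
    by blast
  moreover have "(\<Sum>k\<in>{2..n}. ?w (d + e) k) mod (2 * n - 4)
      = (\<Sum>k\<in>{2..n}. ?w (d + f) k) mod (2 * n - 4)"
    unfolding w sum.distrib[of "?w d"]
    using assms by (intro mod_add_cong refl) (simp add: signature_def)
  ultimately show ?thesis
    using assms unfolding signature_def by (simp add: zero)
qed

lemma lookup_sum_single:
  "finite A \<Longrightarrow> Poly_Mapping.lookup (\<Sum>k\<in>A. Poly_Mapping.single k (1::nat)) l = of_bool (l \<in> A)"
  by (induction A rule: finite_induct) (auto simp: lookup_add lookup_single when_def)

lemma sum_single_eq_0_iff:
  "finite A \<Longrightarrow> (\<Sum>k\<in>A. Poly_Mapping.single k (1::nat)) = 0 \<longleftrightarrow> A = {}"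
  by (metis keys_eq_empty sum_single_keys)

text \<open>
  For \<open>i = 1\<close> both sides have weight \<open>1\<close> at every \<open>k \<ge> 2\<close>. For \<open>i \<ge> 2\<close> both have weight \<open>1\<close> at \<open>i\<close>,
  while at the \<open>n - 2\<close> other places the product has weight \<open>2\<close> and \<open>x\<^sub>i\<close> has weight \<open>0\<close>; the total
  degrees differ by \<open>2 (n - 2)\<close>, which is where the modulus \<open>2n - 4\<close> comes from.
\<close>

lemma signature_generator:
  assumes "n \<ge> 3" "i \<in> {1..n}"
  shows "signature n (\<Sum>j\<in>{1..n} - {i}. Poly_Mapping.single j 1)
    = signature n (Poly_Mapping.single i 1)"
proof -
  let ?w = "\<lambda>e k. Poly_Mapping.lookup e k + Poly_Mapping.lookup e (1::nat) :: nat"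
  let ?e = "\<Sum>j\<in>{1..n} - {i}. Poly_Mapping.single j (1::nat)"
  let ?f = "Poly_Mapping.single i (1::nat)"
  have zero: "?e \<noteq> 0" "?f \<noteq> 0"
  proof -
    (* Some index other than i exists, so the product is not empty. *)
    have "(if i = 1 then 2 else 1) \<in> {1..n} - {i}" using assms by auto
    then have "{1..n} - {i} \<noteq> {}" by blast
    then show "?e \<noteq> 0" by (simp add: sum_single_eq_0_iff del: Diff_eq_empty_iff)
    show "?f \<noteq> 0" by (metis lookup_single_eq lookup_zero zero_neq_one)
  qed
  have w: "?w ?e k = (if i = 1 \<or> k = i then 1 else 2)"
    "?w ?f k = (if i = 1 \<or> k = i then 1 else 0)" if "k \<in> {2..n}" for k
    using that assms by (auto simp: lookup_sum_single lookup_single when_def)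
  have "odd (?w ?e k) \<longleftrightarrow> odd (?w ?f k)" if "k \<in> {2..n}" for k
    unfolding w[OF that] by simp
  then have "{k \<in> {2..n - 1}. odd (?w ?e k)} = {k \<in> {2..n - 1}. odd (?w ?f k)}"
    by force
  moreover have "(\<Sum>k\<in>{2..n}. ?w ?e k) mod (2 * n - 4) = (\<Sum>k\<in>{2..n}. ?w ?f k) mod (2 * n - 4)"
  proof (cases "i = 1")
    case True
    have "(\<Sum>k\<in>{2..n}. ?w ?e k) = (\<Sum>k\<in>{2..n}. ?w ?f k)"
    proof (rule sum.cong[OF refl])
      fix k assume "k \<in> {2..n}"
      from w[OF this] show "?w ?e k = ?w ?f k" using True by simp
    qed
    then show ?thesis by (simp only:)
  next
    case False
    then have i: "i \<in> {2..n}" using assms by auto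
    have wi: "?w ?e i = 1" "?w ?f i = 1" using w[OF i] by simp_all
    have w': "?w ?e k = 2" "?w ?f k = 0" if "k \<in> {2..n} - {i}" for k
      using w[of k] that False by auto
    have "(\<Sum>k\<in>{2..n}. ?w ?e k) = 1 + (\<Sum>k\<in>{2..n} - {i}. ?w ?e k)"
      by (subst sum.remove[OF _ i]) (simp_all only: wi finite_atLeastAtMost)
    also have "(\<Sum>k\<in>{2..n} - {i}. ?w ?e k) = (\<Sum>k\<in>{2..n} - {i}. 2)"
      by (intro sum.cong refl w')
    also have "(\<Sum>k\<in>{2..n} - {i}. 2) = 2 * n - 4"
      using i by (simp add: diff_mult_distrib)
    finally have e: "(\<Sum>k\<in>{2..n}. ?w ?e k) = 1 + (2 * n - 4)" .
    have "(\<Sum>k\<in>{2..n}. ?w ?f k) = 1 + (\<Sum>k\<in>{2..n} - {i}. ?w ?f k)"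
      by (subst sum.remove[OF _ i]) (simp_all only: wi finite_atLeastAtMost)
    also have "(\<Sum>k\<in>{2..n} - {i}. ?w ?f k) = 0"
      by (intro sum.neutral ballI w')
    finally show ?thesis using e by simp
  qed
  ultimately show ?thesis using zero unfolding signature_def by simp
qed

text \<open>
  The linear form on polynomials that takes the value \<open>u e\<close> on the monomial with exponent \<open>e\<close>.
\<close>

definition functional :: "((nat \<Rightarrow>\<^sub>0 nat) \<Rightarrow> 'a) \<Rightarrow> 'a::field multipoly \<Rightarrow> 'a" where
  "functional u p = (\<Sum>e\<in>Poly_Mapping.keys p. Poly_Mapping.lookup p e * u e)"

lemma functional_superset:
  "finite A \<Longrightarrow> Poly_Mapping.keys p \<subseteq> A \<Longrightarrow>
    functional u p = (\<Sum>e\<in>A. Poly_Mapping.lookup p e * u e)"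
  unfolding functional_def by (rule sum.mono_neutral_left) (auto simp: in_keys_iff)

lemma functional_add: "functional u (p + q) = functional u p + functional u q"
proof -
  let ?A = "Poly_Mapping.keys p \<union> Poly_Mapping.keys q"
  have "functional u (p + q) = (\<Sum>e\<in>?A. Poly_Mapping.lookup (p + q) e * u e)"
    by (rule functional_superset) (simp_all add: Poly_Mapping.keys_add)
  also have "\<dots> = functional u p + functional u q"
    by (simp add: functional_superset[where A = ?A] lookup_add distrib_right sum.distrib)
  finally show ?thesis .
qed

lemma functional_zero [simp]: "functional u 0 = 0"
  by (simp add: functional_def)

lemma functional_uminus: "functional u (- p) = - functional u p"
  using functional_add[of u p "- p"] by (simp add: add_eq_0_iff)

lemma functional_diff: "functional u (p - q) = functional u p - functional u q"
  using functional_add[of u p "- q"] by (simp add: functional_uminus)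

lemma functional_sum: "functional u (\<Sum>s\<in>A. f s) = (\<Sum>s\<in>A. functional u (f s))"
  by (induction A rule: infinite_finite_induct) (simp_all add: functional_add)

lemma functional_single [simp]: "functional u (Poly_Mapping.single e c) = c * u e"
  by (simp add: functional_def)

lemma sum_monomials:
  "(\<Sum>e\<in>Poly_Mapping.keys p. Poly_Mapping.single e (Poly_Mapping.lookup p e)) = p"
  by (rule poly_mapping_eqI)
    (simp add: lookup_sum lookup_single when_def sum.delta in_keys_iff)

lemma functional_single_mult:
  "functional u (Poly_Mapping.single d c * p) = c * functional (\<lambda>e. u (d + e)) p"
proof -
  have "functional u (Poly_Mapping.single d c * p)
      = functional u (\<Sum>e\<in>Poly_Mapping.keys p.
          Poly_Mapping.single (d + e) (c * Poly_Mapping.lookup p e))"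
    by (subst (1) sum_monomials[of p, symmetric]) (simp add: sum_distrib_left mult_single)
  also have "\<dots> = c * functional (\<lambda>e. u (d + e)) p"
    by (simp add: functional_sum functional_def[of "\<lambda>e. u (d + e)"] sum_distrib_left mult.assoc)
  finally show ?thesis .
qed

definition signature_invariant :: "nat \<Rightarrow> ((nat \<Rightarrow>\<^sub>0 nat) \<Rightarrow> 'a) \<Rightarrow> bool" where
  "signature_invariant n u \<longleftrightarrow> (\<forall>e f. signature n e = signature n f \<longrightarrow> u e = u f)"

lemma signature_invariant_shift:
  "signature_invariant n u \<Longrightarrow> signature_invariant n (\<lambda>e. u (d + e))"
  unfolding signature_invariant_def using signature_add_cong by blast

text \<open>
  Quantifying over all invariant weights at once makes the common kernel an ideal: multiplication
  by a monomial of exponent \<open>d\<close> replaces the weight \<open>u\<close> by its shift \<open>e \<mapsto> u (d + e)\<close>, which is again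
  invariant. On a generator both monomials receive the same weight, with opposite signs.
\<close>

lemma functional_vanishes_on_binom_ideal:
  fixes u :: "(nat \<Rightarrow>\<^sub>0 nat) \<Rightarrow> 'a::field"
  assumes "n \<ge> 3" "signature_invariant n u" "p \<in> binom_ideal n"
  shows "functional u p = 0"
proof -
  define J :: "'a multipoly set" where
    "J = {p \<in> carrier (poly_ring n). \<forall>u. signature_invariant n u \<longrightarrow> functional u p = 0}"
  have mult: "q * p \<in> J" if "p \<in> J" "q \<in> carrier (poly_ring n)" for p q
  proof -
    have "functional u (q * p) = 0" if u: "signature_invariant n u" for u
    proof -
      have "q * p = (\<Sum>d\<in>Poly_Mapping.keys q. Poly_Mapping.single d (Poly_Mapping.lookup q d) * p)"
        by (simp add: sum_monomials sum_distrib_right[symmetric])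
      then have "functional u (q * p) = (\<Sum>d\<in>Poly_Mapping.keys q.
          Poly_Mapping.lookup q d * functional (\<lambda>e. u (d + e)) p)"
        by (simp add: functional_sum functional_single_mult)
      also have "\<dots> = 0"
        using \<open>p \<in> J\<close> signature_invariant_shift[OF u] by (simp add: J_def)
      finally show ?thesis .
    qed
    then show ?thesis using that by (simp add: J_def mult_mem_carrier)
  qed
  have "ideal J (poly_ring n)"
  proof (rule idealI)
    show "subgroup J (add_monoid (poly_ring n))"
    proof (rule poly_ring.add.subgroupI)
      show "J \<subseteq> carrier (poly_ring n)" by (auto simp: J_def)
      have "0 \<in> J" by (simp add: J_def mem_carrier_poly_ring)
      then show "J \<noteq> {}" by blast
      fix a assume a: "a \<in> J"
      then show "\<ominus>\<^bsub>poly_ring n\<^esub> a \<in> J"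
        by (simp add: J_def uminus_poly_ring functional_uminus uminus_mem_carrier)
      fix b assume "b \<in> J"
      then show "a \<oplus>\<^bsub>poly_ring n\<^esub> b \<in> J"
        using a by (simp add: J_def functional_add add_mem_carrier)
    qed
  qed (use mult in \<open>simp_all add: poly_ring.ring_axioms mult.commute\<close>)
  moreover have "generators n \<subseteq> J"
  proof
    fix g :: "'a multipoly" assume g: "g \<in> generators n"
    then obtain i where i: "i \<in> {1..n}" "g = (\<Prod>j\<in>{1..n} - {i}. var j) - var i"
      unfolding generators_def by blast
    have "functional u g = 0" if "signature_invariant n u" for u
    proof -
      have "u (\<Sum>j\<in>{1..n} - {i}. Poly_Mapping.single j 1) = u (Poly_Mapping.single i 1)"
        using that signature_generator[OF assms(1) i(1)] unfolding signature_invariant_def by blast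
      then show ?thesis unfolding i(2) prod_var by (simp add: var_def functional_diff)
    qed
    then show "g \<in> J" using g generators_subset by (auto simp: J_def)
  qed
  ultimately have "binom_ideal n \<subseteq> J"
    unfolding binom_ideal_eq by (rule poly_ring.genideal_minimal)
  then show ?thesis using assms(2,3) by (auto simp: J_def)
qed

text \<open>
  The functional weighted by the indicator of the class of \<open>e\<close> tells the two monomials apart unless
  their signatures agree.
\<close>

lemma residue_class_monomial_eqD:
  assumes "n \<ge> 3" "Poly_Mapping.keys e \<subseteq> {1..n}" "Poly_Mapping.keys f \<subseteq> {1..n}"
    and "residue_class n (monomial e :: 'a::field multipoly) = residue_class n (monomial f)"
  shows "signature n e = signature n f"
proof -
  define u :: "(nat \<Rightarrow>\<^sub>0 nat) \<Rightarrow> 'a" where "u g = of_bool (signature n g = signature n e)" for g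
  have "monomial e - monomial f \<in> (binom_ideal n :: 'a multipoly set)"
    using assms by (simp add: residue_class_eq_iff single_mem_carrier)
  then have "functional u (monomial e - monomial f) = 0"
    by (intro functional_vanishes_on_binom_ideal[OF assms(1)]) (auto simp: signature_invariant_def u_def)
  then show ?thesis by (auto simp: functional_diff u_def split: if_splits)
qed

section \<open>The basis monomials\<close>

text \<open>
  The pair \<open>(b, T)\<close> stands for the basis monomial \<open>x\<^sub>n\<^sup>b \<Prod>\<^bsub>k\<in>T\<^esub> x\<^sub>k\<close>.
\<close>

definition basis_index :: "nat \<Rightarrow> (nat \<times> nat set) set" where
  "basis_index n = {..<2 * n - 4} \<times> Pow {2..n - 1} \<union> {(2 * n - 4, {})}"

definition basis_exponent :: "nat \<Rightarrow> nat \<times> nat set \<Rightarrow> nat \<Rightarrow>\<^sub>0 nat" where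
  "basis_exponent n = (\<lambda>(b, T). Poly_Mapping.single n b + (\<Sum>k\<in>T. Poly_Mapping.single k 1))"

lemma basis_monomial_eq: "basis_monomial n b T = monomial (basis_exponent n (b, T))"
  by (simp add: basis_monomial_def basis_exponent_def var_power prod_var monomial_mult)

lemma basis_monomials_eq:
  "basis_monomials n = (\<lambda>x. monomial (basis_exponent n x)) ` basis_index n"
  unfolding basis_monomials_def basis_index_def basis_monomial_eq by auto

lemma basis_index_subset: "(b, T) \<in> basis_index n \<Longrightarrow> T \<subseteq> {2..n - 1}"
  by (auto simp: basis_index_def)

lemma middle_subsetD:
  fixes n :: nat
  assumes "T \<subseteq> {2..n - 1}" "k \<in> T"
  shows "2 \<le> k" "k < n"
proof -
  have "k \<in> {2..n - 1}" using assms by blast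
  then show "2 \<le> k" "k < n" by auto
qed

lemma middle_subset:
  assumes "T \<subseteq> {2..n - 1}"
  shows "T \<subseteq> {1..n :: nat}"
proof
  fix k assume "k \<in> T"
  from middle_subsetD[OF assms this] show "k \<in> {1..n}" by simp
qed

lemma basis_exponent_keys:
  assumes "n \<ge> 3" "x \<in> basis_index n"
  shows "Poly_Mapping.keys (basis_exponent n x) \<subseteq> {1..n}"
proof -
  obtain b T where x: "x = (b, T)" by force
  with assms basis_index_subset have T: "T \<subseteq> {2..n - 1}" by blast
  then have "finite T" by (rule finite_subset) simp
  then show ?thesis
    using middle_subset[OF T] assms(1)
    by (auto simp: x basis_exponent_def keys_add_nat sum_single_keys)
qed

lemma basis_monomials_carrier:
  "n \<ge> 3 \<Longrightarrow> m \<in> basis_monomials n \<Longrightarrow> m \<in> carrier (poly_ring n)"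
  unfolding basis_monomials_eq using basis_exponent_keys single_mem_carrier by blast

text \<open>
  The parity set recovers \<open>T\<close>, since \<open>x\<^sub>1\<close> does not occur and \<open>x\<^sub>n\<close> lies outside the range of the
  parities.
\<close>

lemma signature_basis_exponent:
  assumes "n \<ge> 3" "T \<subseteq> {2..n - 1}"
  shows "signature n (basis_exponent n (b, T)) = (b = 0 \<and> T = {}, T, (b + card T) mod (2 * n - 4))"
proof -
  let ?e = "basis_exponent n (b, T)"
  have fin: "finite T" using assms(2) by (rule finite_subset) simp
  have w: "Poly_Mapping.lookup ?e k + Poly_Mapping.lookup ?e 1
      = (if k = n then b else 0) + of_bool (k \<in> T)" for k
    using assms fin
    by (auto simp: basis_exponent_def lookup_add lookup_sum_single lookup_single when_def
       )
  have "?e = 0 \<longleftrightarrow> b = 0 \<and> T = {}"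
    by (simp add: keys_eq_empty[symmetric] basis_exponent_def keys_add_nat sum_single_keys fin
        del: keys_eq_empty)
  moreover have "{k \<in> {2..n - 1}. odd ((if k = n then b else 0) + of_bool (k \<in> T))} = T"
    using assms by auto
  moreover have "(\<Sum>k\<in>{2..n}. (if k = n then b else 0) + of_bool (k \<in> T)) = b + card T"
  proof -
    have "{2..n} \<inter> T = T" using middle_subsetD[OF assms(2)] by (auto simp: less_imp_le)
    then show ?thesis using assms(1) by (simp add: sum.distrib)
  qed
  ultimately show ?thesis unfolding signature_def w by simp
qed

text \<open>
  Once \<open>T\<close> is known, the degree gives \<open>b\<close> modulo \<open>2n - 4\<close>. The only ambiguity left is \<open>b = 0\<close> against
  \<open>b = 2n - 4\<close> with \<open>T = {}\<close>, which the first component of the signature resolves.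
\<close>

lemma inj_on_signature_basis_exponent:
  assumes "n \<ge> 3"
  shows "inj_on (\<lambda>x. signature n (basis_exponent n x)) (basis_index n)"
proof (rule inj_onI)
  fix x y
  assume x: "x \<in> basis_index n" and y: "y \<in> basis_index n"
    and eq: "signature n (basis_exponent n x) = signature n (basis_exponent n y)"
  obtain b T c U where xy: "x = (b, T)" "y = (c, U)" by force
  have sub: "T \<subseteq> {2..n - 1}" "U \<subseteq> {2..n - 1}"
    using x y unfolding xy by (blast dest: basis_index_subset)+
  have U: "U = T" and zero: "b = 0 \<and> T = {} \<longleftrightarrow> c = 0 \<and> T = {}"
    and "(b + card T) mod (2 * n - 4) = (c + card T) mod (2 * n - 4)"
    using eq unfolding xy signature_basis_exponent[OF assms sub(1)]
      signature_basis_exponent[OF assms sub(2)] by auto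
  then have "b mod (2 * n - 4) = c mod (2 * n - 4)"
    using cong_add_rcancel_nat[of b "card T" c "2 * n - 4"] by (simp add: cong_def)
  moreover have "b < 2 * n - 4 \<or> b = 2 * n - 4 \<and> T = {}" "c < 2 * n - 4 \<or> c = 2 * n - 4 \<and> T = {}"
    using x y by (auto simp: xy U basis_index_def)
  ultimately show "x = y"
    using zero by (auto simp: xy U)
qed

lemma card_basis_monomials:
  assumes "n \<ge> 3"
  shows "card (basis_monomials n :: 'a::field multipoly set) = c_dim n"
proof -
  have "inj_on (\<lambda>x. monomial (basis_exponent n x) :: 'a multipoly) (basis_index n)"
  proof (rule inj_onI)
    fix x y assume xy: "x \<in> basis_index n" "y \<in> basis_index n"
      and "monomial (basis_exponent n x) = (monomial (basis_exponent n y) :: 'a multipoly)"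
    then have "basis_exponent n x = basis_exponent n y"
      by (metis keys_single singleton_inject zero_neq_one)
    then show "x = y"
      using inj_onD[OF inj_on_signature_basis_exponent[OF assms] _ xy] by simp
  qed
  then have "card (basis_monomials n :: 'a multipoly set) = card (basis_index n)"
    unfolding basis_monomials_eq by (rule card_image)
  also have "\<dots> = (2 * n - 4) * 2 ^ (n - 2) + 1"
    unfolding basis_index_def
    by (subst card_Un_disjoint) (simp_all add: card_cartesian_product card_Pow)
  also have "\<dots> = c_dim n"
  proof -
    obtain m where "n = 2 + m" using le_Suc_ex[of 2 n] assms by auto
    then show ?thesis by (simp add: c_dim_def)
  qed
  finally show ?thesis .
qed

section \<open>Reduction to basis monomials\<close>

lemma residue_class_prod_cong:
  fixes f g :: "'b \<Rightarrow> 'a::field multipoly"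
  assumes "finite A"
    and "\<And>j. j \<in> A \<Longrightarrow> f j \<in> carrier (poly_ring n)" "\<And>j. j \<in> A \<Longrightarrow> g j \<in> carrier (poly_ring n)"
    and "\<And>j. j \<in> A \<Longrightarrow> residue_class n (f j) = residue_class n (g j)"
  shows "(\<Prod>j\<in>A. f j) \<in> carrier (poly_ring n) \<and> (\<Prod>j\<in>A. g j) \<in> carrier (poly_ring n) \<and>
    residue_class n (\<Prod>j\<in>A. f j) = residue_class n (\<Prod>j\<in>A. g j)"
  using assms
  by (induction A rule: finite_induct)
    (simp_all add: one_mem_carrier mult_mem_carrier residue_class_mult)

lemma residue_class_prod_others:
  assumes "i \<in> {1..n}"
  shows "residue_class n (\<Prod>j\<in>{1..n} - {i}. var j) = residue_class n (var i :: 'a::field multipoly)"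
proof -
  have "(\<Prod>j\<in>{1..n} - {i}. var j) - var i \<in> (generators n :: 'a multipoly set)"
    using assms by (auto simp: generators_def)
  then have "(\<Prod>j\<in>{1..n} - {i}. var j) - var i \<in> (binom_ideal n :: 'a multipoly set)"
    unfolding binom_ideal_eq using poly_ring.genideal_self[OF generators_subset] by blast
  then show ?thesis
    using assms by (subst residue_class_eq_iff) (auto intro!: prod_var_mem_carrier var_mem_carrier)
qed

text \<open>
  Multiplying the \<open>i\<close>-th generator by \<open>x\<^sub>i\<close> gives \<open>x\<^sub>i\<^sup>2 = x\<^sub>1\<cdots>x\<^sub>n\<close> for every \<open>i\<close>.
\<close>

lemma residue_class_square:
  assumes "i \<in> {1..n}" "j \<in> {1..n}"
  shows "residue_class n (var i ^ 2) = residue_class n (var j ^ 2 :: 'a::field multipoly)"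
proof -
  have "residue_class n (var i ^ 2 :: 'a multipoly) = residue_class n (\<Prod>k\<in>{1..n}. var k)"
    if i: "i \<in> {1..n}" for i
  proof -
    have "residue_class n (var i * (\<Prod>k\<in>{1..n} - {i}. var k)) = residue_class n (var i * var i :: 'a multipoly)"
      by (rule residue_class_mult_cong[OF prod_var_mem_carrier _ _ residue_class_prod_others[OF i]])
        (use i in \<open>auto intro!: var_mem_carrier\<close>)
    then show ?thesis
      using prod.remove[of "{1..n}" i "var :: nat \<Rightarrow> 'a multipoly"] i by (simp add: power2_eq_square)
  qed
  then show ?thesis using assms by simp
qed

text \<open>
  Replace \<open>x\<^sub>1\<close> by \<open>x\<^sub>2\<cdots>x\<^sub>n\<close> in \<open>x\<^sub>i = \<Prod>\<^bsub>j\<noteq>i\<^esub> x\<^sub>j\<close>: the right-hand side becomes \<open>x\<^sub>i\<close> times the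
  squares of the \<open>n - 2\<close> other variables among \<open>x\<^sub>2,\<dots>,x\<^sub>n\<close>, and each square equals \<open>x\<^sub>n\<^sup>2\<close>.
\<close>

lemma residue_class_mult_last_power:
  assumes "n \<ge> 3" "i \<in> {2..n}"
  shows "residue_class n (var i * var n ^ (2 * n - 4)) = residue_class n (var i :: 'a::field multipoly)"
proof -
  let ?A = "{2..n} - {i}"
  have A: "?A \<subseteq> {1..n}" "i \<in> {1..n}" "1 \<in> {1..n}" "n \<in> {1..n}" using assms by auto
  have "residue_class n (var i :: 'a multipoly) = residue_class n (\<Prod>j\<in>{1..n} - {i}. var j)"
    using residue_class_prod_others[OF A(2)] by (rule sym)
  also have "{1..n} - {i} = insert 1 ?A" using assms by auto
  also have "(\<Prod>j\<in>insert 1 ?A. var j :: 'a multipoly) = (\<Prod>j\<in>?A. var j) * var 1"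
    by (subst prod.insert) (auto simp: mult.commute)
  also have "residue_class n \<dots> = residue_class n ((\<Prod>j\<in>?A. var j) * (\<Prod>j\<in>{1..n} - {1}. var j))"
    using residue_class_prod_others[OF A(3)] A
    by (intro residue_class_mult_cong prod_var_mem_carrier var_mem_carrier) auto
  also have "{1..n} - {1} = insert i ?A" using assms by auto
  also have "(\<Prod>j\<in>?A. var j) * (\<Prod>j\<in>insert i ?A. var j)
      = var i * (\<Prod>j\<in>?A. var j ^ 2 :: 'a multipoly)"
    by (subst prod.insert) (auto simp: power2_eq_square prod.distrib mult_ac)
  also have "residue_class n \<dots> = residue_class n (var i * (\<Prod>j\<in>?A. var n ^ 2))"
  proof -
    have "(\<Prod>j\<in>?A. var j ^ 2 :: 'a multipoly) \<in> carrier (poly_ring n) \<and>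
        (\<Prod>j\<in>?A. var n ^ 2 :: 'a multipoly) \<in> carrier (poly_ring n) \<and>
        residue_class n (\<Prod>j\<in>?A. var j ^ 2 :: 'a multipoly) = residue_class n (\<Prod>j\<in>?A. var n ^ 2)"
      using A by (intro residue_class_prod_cong) (auto intro!: var_power_mem_carrier residue_class_square)
    then show ?thesis
      using var_mem_carrier[OF A(2)] by (intro residue_class_mult_cong) simp_all
  qed
  also have "(\<Prod>j\<in>?A. var n ^ 2 :: 'a multipoly) = var n ^ (2 * n - 4)"
    using assms by (simp add: power_mult[symmetric] diff_mult_distrib2)
  finally show ?thesis by (rule sym)
qed

definition reducible_to_basis :: "nat \<Rightarrow> 'a::field multipoly \<Rightarrow> bool" where
  "reducible_to_basis n p \<longleftrightarrow> (\<exists>m\<in>basis_monomials n. residue_class n p = residue_class n m)"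

lemma basis_monomial_carrier:
  assumes "n \<ge> 3" "T \<subseteq> {2..n - 1}"
  shows "basis_monomial n b T \<in> carrier (poly_ring n)"
  unfolding basis_monomial_def using assms(1) middle_subset[OF assms(2)]
  by (intro mult_mem_carrier var_power_mem_carrier prod_var_mem_carrier) auto

text \<open>
  A power of \<open>x\<^sub>n\<close> that is too large can be lowered by \<open>2n - 4\<close> as soon as some variable is left to
  absorb \<open>x\<^sub>n\<^sup>2\<^sup>n\<^sup>-\<^sup>4\<close>: a variable from \<open>T\<close>, or \<open>x\<^sub>n\<close> itself when \<open>T\<close> is empty. The second option needs
  \<open>b > 2n - 4\<close>, which is why \<open>x\<^sub>n\<^sup>2\<^sup>n\<^sup>-\<^sup>4\<close> is a basis monomial.
\<close>

lemma reducible_basis_monomial: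
  assumes n: "n \<ge> 3" and T: "T \<subseteq> {2..n - 1}"
  shows "reducible_to_basis n (basis_monomial n b T :: 'a::field multipoly)"
proof (induction b rule: less_induct)
  case (less b)
  have fin: "finite T" using T by (rule finite_subset) simp
  consider "b < 2 * n - 4 \<or> b = 2 * n - 4 \<and> T = {}" | k where "b \<ge> 2 * n - 4" "k \<in> T"
    | "b > 2 * n - 4" "T = {}"
    by fastforce
  then show ?case
  proof cases
    case 1
    then have "basis_monomial n b T \<in> basis_monomials n"
      using T unfolding basis_monomials_def by blast
    then show ?thesis unfolding reducible_to_basis_def by blast
  next
    case 2
    let ?b = "b - (2 * n - 4)"
    have k: "k \<in> {2..n}" "k \<in> {1..n}" using middle_subsetD[OF T 2(2)] by auto
    have T': "T - {k} \<subseteq> {2..n - 1}" using T by blast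
    have split: "(\<Prod>j\<in>T. var j) = var k * (\<Prod>j\<in>T - {k}. var j :: 'a multipoly)"
      using fin 2(2) by (rule prod.remove)
    have "var n ^ b = var n ^ ?b * (var n ^ (2 * n - 4) :: 'a multipoly)"
      using 2(1) by (simp add: power_add[symmetric])
    then have "basis_monomial n b T = basis_monomial n ?b (T - {k}) * (var k * var n ^ (2 * n - 4) :: 'a multipoly)"
      by (simp add: basis_monomial_def split mult_ac)
    also have "residue_class n \<dots> = residue_class n (basis_monomial n ?b (T - {k}) * var k)"
      using n k by (intro residue_class_mult_cong residue_class_mult_last_power
          basis_monomial_carrier T' mult_mem_carrier var_power_mem_carrier var_mem_carrier) auto
    also have "basis_monomial n ?b (T - {k}) * var k = (basis_monomial n ?b T :: 'a multipoly)"
      by (simp add: basis_monomial_def split mult_ac)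
    finally show ?thesis
      using less[of ?b] 2(1) n by (simp add: reducible_to_basis_def)
  next
    case 3
    let ?b = "b - (2 * n - 4)"
    have "var n ^ b = var n ^ (?b - 1) * (var n * var n ^ (2 * n - 4) :: 'a multipoly)"
      using 3(1) by (simp add: power_add[symmetric] power_Suc[symmetric] del: power_Suc)
    then have "residue_class n (basis_monomial n b T)
        = residue_class n (var n ^ (?b - 1) * (var n * var n ^ (2 * n - 4) :: 'a multipoly))"
      by (simp add: basis_monomial_def 3(2))
    also have "\<dots> = residue_class n (var n ^ (?b - 1) * var n)"
      using n by (intro residue_class_mult_cong residue_class_mult_last_power
          mult_mem_carrier var_power_mem_carrier var_mem_carrier) auto
    also have "var n ^ (?b - 1) * var n = (basis_monomial n ?b T :: 'a multipoly)"
    proof -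
      have "?b = Suc (?b - 1)" using 3(1) by simp
      then have "var n ^ (?b - 1) * var n = (var n ^ ?b :: 'a multipoly)" by (metis power_Suc2)
      then show ?thesis by (simp add: basis_monomial_def 3(2))
    qed
    finally show ?thesis
      using less[of ?b] 3(1) n by (simp add: reducible_to_basis_def)
  qed
qed

text \<open>
  If \<open>x\<^sub>i\<close> already occurs in the squarefree part, the square that arises is turned into \<open>x\<^sub>n\<^sup>2\<close>; in all
  cases the result has the shape of a basis monomial, up to the size of the power of \<open>x\<^sub>n\<close>.
\<close>

lemma reducible_var_mult_basis_monomial:
  assumes n: "n \<ge> 3" and i: "i \<in> {2..n}" and T: "T \<subseteq> {2..n - 1}"
  shows "reducible_to_basis n (var i * basis_monomial n b T :: 'a::field multipoly)"
proof -
  have fin: "finite T" using T by (rule finite_subset) simp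
  consider "i = n" | "i \<noteq> n" "i \<notin> T" | "i \<in> T" by blast
  then show ?thesis
  proof cases
    case 1
    then have "var i * basis_monomial n b T = (basis_monomial n (Suc b) T :: 'a multipoly)"
      by (simp add: basis_monomial_def mult_ac)
    then show ?thesis using reducible_basis_monomial[OF n T] by simp
  next
    case 2
    then have "var i * basis_monomial n b T = (basis_monomial n b (insert i T) :: 'a multipoly)"
      using fin by (simp add: basis_monomial_def mult_ac)
    moreover have "insert i T \<subseteq> {2..n - 1}" using 2 T i by auto
    ultimately show ?thesis using reducible_basis_monomial[OF n, of "insert i T" b, where 'a = 'a] by simp
  next
    case 3
    have T': "T - {i} \<subseteq> {2..n - 1}" using T by blast
    have "var i * basis_monomial n b T = basis_monomial n b (T - {i}) * (var i ^ 2 :: 'a multipoly)"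
      using prod.remove[OF fin 3, of "var :: nat \<Rightarrow> 'a multipoly"]
      by (simp add: basis_monomial_def mult_ac power2_eq_square)
    also have "residue_class n \<dots> = residue_class n (basis_monomial n b (T - {i}) * var n ^ 2)"
      using n i by (intro residue_class_mult_cong residue_class_square
          basis_monomial_carrier T' var_power_mem_carrier) auto
    also have "basis_monomial n b (T - {i}) * var n ^ 2
        = (basis_monomial n (b + 2) (T - {i}) :: 'a multipoly)"
      by (simp add: basis_monomial_def mult_ac power_add power2_eq_square)
    finally show ?thesis
      using reducible_basis_monomial[OF n T', of "b + 2"] by (simp add: reducible_to_basis_def)
  qed
qed

lemma reducible_prod_mult:
  assumes n: "n \<ge> 3" and A: "A \<subseteq> {2..n}"
    and p: "p \<in> carrier (poly_ring n)" "reducible_to_basis n p"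
  shows "reducible_to_basis n ((\<Prod>j\<in>A. var j) * p :: 'a::field multipoly)"
proof -
  have "finite A" using A by (rule finite_subset) simp
  then show ?thesis using A
  proof (induction A rule: finite_induct)
    case empty
    then show ?case using p by simp
  next
    case (insert i A)
    let ?q = "(\<Prod>j\<in>A. var j) * p"
    have i: "i \<in> {2..n}" "i \<in> {1..n}" using insert.prems by auto
    have q: "?q \<in> carrier (poly_ring n)"
      using insert.prems p by (intro mult_mem_carrier prod_var_mem_carrier) auto
    obtain m where m: "m \<in> basis_monomials n" "residue_class n ?q = residue_class n m"
      using insert by (auto simp: reducible_to_basis_def)
    then obtain b T where bT: "m = basis_monomial n b T" "T \<subseteq> {2..n - 1}"
      unfolding basis_monomials_def by blast
    have "residue_class n (var i * ?q) = residue_class n (var i * m)"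
      by (rule residue_class_mult_cong[OF q basis_monomials_carrier[OF n m(1)] var_mem_carrier[OF i(2)] m(2)])
    then show ?case
      using reducible_var_mult_basis_monomial[OF n i(1) bT(2), where 'a = 'a] insert.hyps
      by (simp add: reducible_to_basis_def bT mult.assoc)
  qed
qed

text \<open>
  The variable \<open>x\<^sub>1\<close> is traded for \<open>x\<^sub>2\<cdots>x\<^sub>n\<close>, whose factors are multiplied in one at a time.
\<close>

lemma reducible_var_mult:
  assumes n: "n \<ge> 3" and i: "i \<in> {1..n}" and m: "m \<in> basis_monomials n"
  shows "reducible_to_basis n (var i * m :: 'a::field multipoly)"
proof -
  have m': "m \<in> carrier (poly_ring n)" "reducible_to_basis n m"
    using m n by (auto simp: basis_monomials_carrier reducible_to_basis_def)
  show ?thesis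
  proof (cases "i = 1")
    case True
    have "{1..n} - {1} = {2..n}" by auto
    then have "residue_class n (m * (\<Prod>j\<in>{2..n}. var j)) = residue_class n (m * var 1)"
      using residue_class_prod_others[of 1 n, where 'a = 'a] n m'(1)
      by (intro residue_class_mult_cong prod_var_mem_carrier var_mem_carrier) auto
    then show ?thesis
      using reducible_prod_mult[OF n subset_refl m']
      by (simp add: True reducible_to_basis_def mult.commute)
  next
    case False
    then show ?thesis using reducible_prod_mult[OF n _ m', of "{i}"] i by simp
  qed
qed

section \<open>Coordinates and the companion matrices\<close>

lemma residue_class_linear_combination:
  fixes f :: "nat \<Rightarrow> 'a::field multipoly"
  assumes "\<And>s. s < c \<Longrightarrow> f s \<in> carrier (poly_ring n)"
  shows "(\<Oplus>\<^bsub>quot_ring n\<^esub> s\<in>{..<c}. scale n (a s) (residue_class n (f s)))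
    = residue_class n (\<Sum>s<c. const (a s) * f s)"
proof -
  have carr: "const (a s) * f s \<in> carrier (poly_ring n)" if "s < c" for s
    using assms that by (intro mult_mem_carrier const_mem_carrier)
  have "residue_class n (\<Sum>s<c. const (a s) * f s)
      = residue_class n (\<Oplus>\<^bsub>poly_ring n\<^esub> s\<in>{..<c}. const (a s) * f s)"
    using carr by (subst finsum_poly_ring) auto
  also have "\<dots> = (\<Oplus>\<^bsub>quot_ring n\<^esub> s\<in>{..<c}. (residue_class n \<circ> (\<lambda>s. const (a s) * f s)) s)"
    using carr by (intro residue.hom_finsum) auto
  also have "\<dots> = (\<Oplus>\<^bsub>quot_ring n\<^esub> s\<in>{..<c}. scale n (a s) (residue_class n (f s)))"
    using assms carr by (intro residue.S.finsum_cong')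
      (auto simp: scale_def residue_class_mult const_mem_carrier)
  finally show ?thesis by (rule sym)
qed

lemma length_basis_enumeration:
  "n \<ge> 3 \<Longrightarrow> basis_enumeration n ms \<Longrightarrow> length ms = c_dim n"
  by (metis basis_enumeration_def card_basis_monomials distinct_card)

lemma basis_enumeration_exponents:
  fixes ms :: "'a::field multipoly list"
  assumes "n \<ge> 3" "basis_enumeration n ms"
  obtains ex where "\<And>s. s < c_dim n \<Longrightarrow> ms ! s = monomial (ex s)"
    "\<And>s. s < c_dim n \<Longrightarrow> Poly_Mapping.keys (ex s) \<subseteq> {1..n}"
    "inj_on (\<lambda>s. signature n (ex s)) {..<c_dim n}"
    "ex 0 = 0"
proof -
  have len: "length ms = c_dim n"
    using assms by (rule length_basis_enumeration)
  have "\<exists>x\<in>basis_index n. ms ! s = monomial (basis_exponent n x)" if "s < c_dim n" for s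
    using that len assms(2) nth_mem[of s ms] by (auto simp: basis_enumeration_def basis_monomials_eq)
  then obtain x where x: "\<And>s. s < c_dim n \<Longrightarrow> x s \<in> basis_index n"
      "\<And>s. s < c_dim n \<Longrightarrow> ms ! s = monomial (basis_exponent n (x s))"
    by metis
  show thesis
  proof (rule that[of "\<lambda>s. basis_exponent n (x s)"])
    show "inj_on (\<lambda>s. signature n (basis_exponent n (x s))) {..<c_dim n}"
    proof (rule inj_onI)
      fix s t assume st: "s \<in> {..<c_dim n}" "t \<in> {..<c_dim n}"
        and "signature n (basis_exponent n (x s)) = signature n (basis_exponent n (x t))"
      then have "x s = x t"
        using inj_onD[OF inj_on_signature_basis_exponent[OF assms(1)]] x(1) by simp
      then have "ms ! s = ms ! t" using st x(2) by simp
      then show "s = t"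
        using st len assms(2) by (simp add: basis_enumeration_def nth_eq_iff_index_eq)
    qed
    have pos: "0 < c_dim n" by (simp add: c_dim_def)
    then have "ms ! 0 = basis_monomial n 0 {}"
      using assms(2) len by (cases ms) (auto simp: basis_enumeration_def)
    then show "basis_exponent n (x 0) = 0"
      using x(2)[OF pos] by (metis basis_monomial_def keys_one keys_single mult_1 power_0
          prod.empty singleton_inject zero_neq_one)
  qed (use x assms(1) basis_exponent_keys in auto)
qed

text \<open>
  That the unit vector is a coordinate vector is clear; that it is the only one, as the definite
  description requires, is the linear independence of the basis. The coefficient at \<open>s\<close> is
  read off by the functional weighted by the indicator of the signature class of the \<open>s\<close>-th element.
\<close>

lemma coordinates_basis_element:
  fixes ms :: "'a::field multipoly list"
  assumes n: "n \<ge> 3" and ms: "basis_enumeration n ms" and t: "t < c_dim n"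
  shows "coordinates n ms (residue_class n (ms ! t)) = unit_vec (c_dim n) t"
proof -
  obtain ex where ex: "\<And>s. s < c_dim n \<Longrightarrow> ms ! s = monomial (ex s)"
    "\<And>s. s < c_dim n \<Longrightarrow> Poly_Mapping.keys (ex s) \<subseteq> {1..n}"
    "inj_on (\<lambda>s. signature n (ex s)) {..<c_dim n}"
    using basis_enumeration_exponents[OF n ms] by metis
  have carr: "ms ! s \<in> carrier (poly_ring n)" if "s < c_dim n" for s
    using that ex by (simp add: single_mem_carrier)
  note combination = residue_class_linear_combination[where c = "c_dim n" and f = "(!) ms", OF carr]
  show ?thesis
    unfolding coordinates_def
  proof (rule the_equality, intro conjI)
    have "(\<Sum>s<c_dim n. const (unit_vec (c_dim n) t $ s) * ms ! s)
        = (\<Sum>s<c_dim n. if s = t then ms ! s else 0)"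
      using t by (intro sum.cong refl) (simp add: const_def)
    also have "\<dots> = ms ! t" using t by simp
    finally show "residue_class n (ms ! t) = (\<Oplus>\<^bsub>quot_ring n\<^esub> s\<in>{..<c_dim n}.
        scale n (unit_vec (c_dim n) t $ s) (residue_class n (ms ! s)))"
      by (simp add: combination)
  next
    fix v :: "'a Matrix.vec"
    assume v: "v \<in> carrier_vec (c_dim n) \<and> residue_class n (ms ! t)
      = (\<Oplus>\<^bsub>quot_ring n\<^esub> s\<in>{..<c_dim n}. scale n (v $ s) (residue_class n (ms ! s)))"
    let ?p = "\<Sum>s<c_dim n. const (v $ s) * ms ! s"
    have "?p \<in> carrier (poly_ring n)"
      using carr by (intro sum_mem_carrier) (auto intro!: mult_mem_carrier const_mem_carrier)
    then have ideal: "ms ! t - ?p \<in> binom_ideal n"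
      using v carr[OF t] by (simp add: combination residue_class_eq_iff)
    show "v = unit_vec (c_dim n) t"
    proof (rule eq_vecI)
      fix s assume "s < dim_vec (unit_vec (c_dim n) t :: 'a Matrix.vec)"
      then have s: "s < c_dim n" by simp
      define u :: "(nat \<Rightarrow>\<^sub>0 nat) \<Rightarrow> 'a" where "u g = of_bool (signature n g = signature n (ex s))" for g
      have u: "u (ex r) = of_bool (r = s)" if "r < c_dim n" for r
        using that s inj_onD[OF ex(3), of r s] by (auto simp: u_def)
      have "functional u (ms ! t - ?p) = 0"
        by (intro functional_vanishes_on_binom_ideal[OF n _ ideal])
          (auto simp: signature_invariant_def u_def)
      moreover have "functional u ?p = (\<Sum>r<c_dim n. if r = s then v $ r else 0)"
        unfolding functional_sum
        by (intro sum.cong refl) (simp add: ex(1) const_def functional_single_mult u)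
      ultimately have "v $ s = of_bool (t = s)"
        using s t by (simp add: functional_diff ex(1) u)
      then show "v $ s = unit_vec (c_dim n) t $ s"
        using s t by auto
    qed (use v in auto)
  qed simp
qed

text \<open>
  The image index is positive because the product with \<open>x\<^sub>i\<close> is not the monomial \<open>1\<close>, a fact
  recorded by the signature, which the residue class determines.
\<close>

lemma variable_action_on_basis:
  fixes ms :: "'a::field multipoly list"
  assumes n: "n \<ge> 3" and ms: "basis_enumeration n ms" and i: "i \<in> {1..n}"
  obtains \<phi> where "\<And>r. r < c_dim n \<Longrightarrow> 0 < \<phi> r \<and> \<phi> r < c_dim n \<and>
    residue_class n (var i * ms ! r) = residue_class n (ms ! \<phi> r)"
proof -
  obtain ex where ex: "\<And>s. s < c_dim n \<Longrightarrow> ms ! s = monomial (ex s)"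
    "\<And>s. s < c_dim n \<Longrightarrow> Poly_Mapping.keys (ex s) \<subseteq> {1..n}" "ex 0 = 0"
    using basis_enumeration_exponents[OF n ms] by metis
  have len: "length ms = c_dim n"
    using n ms by (rule length_basis_enumeration)
  have "\<exists>t. 0 < t \<and> t < c_dim n \<and> residue_class n (var i * ms ! r) = residue_class n (ms ! t)"
    if r: "r < c_dim n" for r
  proof -
    have set: "set ms = basis_monomials n" using ms by (simp add: basis_enumeration_def)
    then have "ms ! r \<in> basis_monomials n" using r len nth_mem by metis
    then have "reducible_to_basis n (var i * ms ! r)"
      by (rule reducible_var_mult[OF n i])
    then obtain t where t: "t < c_dim n"
        "residue_class n (var i * ms ! r) = residue_class n (ms ! t)"
      unfolding reducible_to_basis_def set[symmetric] using len by (metis in_set_conv_nth)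
    have "signature n (Poly_Mapping.single i 1 + ex r) = signature n (ex t)"
    proof (rule residue_class_monomial_eqD[OF n])
      show "residue_class n (monomial (Poly_Mapping.single i 1 + ex r) :: 'a multipoly)
          = residue_class n (monomial (ex t))"
        using t r by (simp add: ex(1) var_def mult_single)
    qed (use ex(2)[OF r] ex(2)[OF t(1)] i in \<open>simp_all add: keys_add_nat\<close>)
    moreover have "Poly_Mapping.single i 1 + ex r \<noteq> 0"
      by (simp add: keys_eq_empty[symmetric] keys_add_nat del: keys_eq_empty)
    ultimately have "ex t \<noteq> 0" by (simp add: signature_def)
    then have "t \<noteq> 0" using ex(3) by metis
    with t show ?thesis by blast
  qed
  then show thesis using that by metis
qed

lemma companion_matrix_index:
  fixes ms :: "'a::field multipoly list"
  assumes n: "n \<ge> 3" and ms: "basis_enumeration n ms" and i: "i \<in> {1..n}"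
    and \<phi>: "\<And>r. r < c_dim n \<Longrightarrow> 0 < \<phi> r \<and> \<phi> r < c_dim n \<and>
      residue_class n (var i * ms ! r) = residue_class n (ms ! \<phi> r)"
    and "r < c_dim n" "s < c_dim n"
  shows "companion_matrix n ms i $$ (r, s) = of_bool (s = \<phi> r)"
proof -
  have "set ms = basis_monomials n" using ms by (simp add: basis_enumeration_def)
  then have "ms ! r \<in> basis_monomials n"
    using assms(5) length_basis_enumeration[OF n ms] nth_mem by metis
  then have "ms ! r \<in> carrier (poly_ring n)"
    by (rule basis_monomials_carrier[OF n])
  then have "mult_map n i (residue_class n (ms ! r)) = residue_class n (var i * ms ! r)"
    using i by (simp add: mult_map_def residue_class_mult var_mem_carrier)
  also have "\<dots> = residue_class n (ms ! \<phi> r)" using \<phi>[OF assms(5)] by blast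
  finally have "coordinates n ms (mult_map n i (residue_class n (ms ! r))) = unit_vec (c_dim n) (\<phi> r)"
    using coordinates_basis_element[OF n ms] \<phi>[OF assms(5)] by simp
  then show ?thesis
    using assms(5,6) \<phi>[OF assms(5)] by (simp add: companion_matrix_def)
qed

lemma companion_matrix_carrier: "companion_matrix n ms i \<in> carrier_mat (c_dim n) (c_dim n)"
  by (simp add: companion_matrix_def)

lemma companion_matrix_first_column:
  assumes "n \<ge> 3" "basis_enumeration n ms" "i \<in> {1..n}" "r < c_dim n"
  shows "companion_matrix n ms i $$ (r, 0) = 0"
proof -
  obtain \<phi> where \<phi>: "\<And>r. r < c_dim n \<Longrightarrow> 0 < \<phi> r \<and> \<phi> r < c_dim n \<and>
      residue_class n (var i * ms ! r) = residue_class n (ms ! \<phi> r)"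
    using variable_action_on_basis[OF assms(1-3)] by blast
  show ?thesis
    using companion_matrix_index[OF assms(1-3) \<phi> assms(4), of 0] \<phi>[OF assms(4)]
    by (simp add: c_dim_def)
qed

text \<open>
  If \<open>\<phi>\<close> and \<open>\<psi>\<close> are the maps on indices given by \<open>x\<^sub>i\<close> and \<open>x\<^sub>j\<close>, then with the row convention
  \<open>T\<^sub>iT\<^sub>j\<close> is the matrix of \<open>\<psi> \<circ> \<phi>\<close>. The maps commute because \<open>x\<^sub>jx\<^sub>im\<^sub>r = x\<^sub>ix\<^sub>jm\<^sub>r\<close> and distinct
  basis elements have distinct classes.
\<close>

lemma companion_matrices_commute:
  fixes ms :: "'a::field multipoly list"
  assumes n: "n \<ge> 3" and ms: "basis_enumeration n ms" and i: "i \<in> {1..n}" and j: "j \<in> {1..n}"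
  shows "companion_matrix n ms i * companion_matrix n ms j
    = companion_matrix n ms j * companion_matrix n ms i"
proof -
  obtain \<phi> where \<phi>: "\<And>r. r < c_dim n \<Longrightarrow> 0 < \<phi> r \<and> \<phi> r < c_dim n \<and>
      residue_class n (var i * ms ! r) = residue_class n (ms ! \<phi> r)"
    using variable_action_on_basis[OF n ms i] by blast
  obtain \<psi> where \<psi>: "\<And>r. r < c_dim n \<Longrightarrow> 0 < \<psi> r \<and> \<psi> r < c_dim n \<and>
      residue_class n (var j * ms ! r) = residue_class n (ms ! \<psi> r)"
    using variable_action_on_basis[OF n ms j] by blast
  obtain ex where ex: "\<And>s. s < c_dim n \<Longrightarrow> ms ! s = monomial (ex s)"
    "\<And>s. s < c_dim n \<Longrightarrow> Poly_Mapping.keys (ex s) \<subseteq> {1..n}"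
    "inj_on (\<lambda>s. signature n (ex s)) {..<c_dim n}"
    using basis_enumeration_exponents[OF n ms] by metis
  have carr: "ms ! s \<in> carrier (poly_ring n)" if "s < c_dim n" for s
    using that ex by (simp add: single_mem_carrier)
  have comm: "\<psi> (\<phi> r) = \<phi> (\<psi> r)" if r: "r < c_dim n" for r
  proof -
    have bounds: "\<phi> r < c_dim n" "\<psi> r < c_dim n" "\<psi> (\<phi> r) < c_dim n" "\<phi> (\<psi> r) < c_dim n"
      using r \<phi> \<psi> by auto
    have "residue_class n (ms ! \<psi> (\<phi> r)) = residue_class n (var j * ms ! \<phi> r)"
      using \<psi> bounds by simp
    also have "\<dots> = residue_class n (var j * (var i * ms ! r))"
      using \<phi>[OF r] bounds r i j
      by (intro residue_class_mult_cong) (simp_all add: carr var_mem_carrier mult_mem_carrier)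
    also have "var j * (var i * ms ! r) = var i * (var j * ms ! r)"
      by (rule mult.left_commute)
    also have "residue_class n \<dots> = residue_class n (var i * ms ! \<psi> r)"
      using \<psi>[OF r] bounds r i j
      by (intro residue_class_mult_cong) (simp_all add: carr var_mem_carrier mult_mem_carrier)
    also have "\<dots> = residue_class n (ms ! \<phi> (\<psi> r))"
      using \<phi> bounds by simp
    finally have "signature n (ex (\<psi> (\<phi> r))) = signature n (ex (\<phi> (\<psi> r)))"
      using bounds by (intro residue_class_monomial_eqD[OF n, where 'a = 'a]) (simp_all add: ex)
    then show ?thesis using inj_onD[OF ex(3)] bounds by simp
  qed
  note dims = carrier_matD[OF companion_matrix_carrier]
  have prod: "(companion_matrix n ms k * companion_matrix n ms l) $$ (r, s) = of_bool (s = \<beta> (\<alpha> r))"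
    if k: "k \<in> {1..n}" and \<alpha>: "\<And>r. r < c_dim n \<Longrightarrow> 0 < \<alpha> r \<and> \<alpha> r < c_dim n \<and>
        residue_class n (var k * ms ! r) = residue_class n (ms ! \<alpha> r)"
      and l: "l \<in> {1..n}" and \<beta>: "\<And>r. r < c_dim n \<Longrightarrow> 0 < \<beta> r \<and> \<beta> r < c_dim n \<and>
        residue_class n (var l * ms ! r) = residue_class n (ms ! \<beta> r)"
      and rs: "r < c_dim n" "s < c_dim n" for k l \<alpha> \<beta> r s
  proof -
    have "(companion_matrix n ms k * companion_matrix n ms l) $$ (r, s)
        = (\<Sum>t\<in>{0..<c_dim n}. companion_matrix n ms k $$ (r, t) * companion_matrix n ms l $$ (t, s))"
      using rs by (simp add: scalar_prod_def dims)
    also have "\<dots> = (\<Sum>t\<in>{0..<c_dim n}. if t = \<alpha> r then of_bool (s = \<beta> t) else 0)"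
      using rs by (intro sum.cong refl)
        (simp add: companion_matrix_index[OF n ms k \<alpha>] companion_matrix_index[OF n ms l \<beta>])
    also have "\<dots> = of_bool (s = \<beta> (\<alpha> r))"
      using \<alpha>[OF rs(1)] by simp
    finally show ?thesis .
  qed
  show ?thesis
    by (rule eq_matI)
      (simp_all add: dims prod[OF i \<phi> j \<psi>] prod[OF j \<psi> i \<phi>] comm del: index_mult_mat(1))
qed

text \<open>
  The entries of the product lose just the summand that passes through index \<open>0\<close>, and its factor from
  the first column of \<open>A\<close> is zero.
\<close>

lemma mat_delete_mult_first_column_zero:
  fixes A B :: "'a::comm_ring_1 Matrix.mat"
  assumes A: "A \<in> carrier_mat (Suc m) (Suc m)" and B: "B \<in> carrier_mat (Suc m) (Suc m)"
    and zero: "\<And>r. r < Suc m \<Longrightarrow> A $$ (r, 0) = 0"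
  shows "mat_delete (A * B) 0 0 = mat_delete A 0 0 * mat_delete B 0 0"
proof (rule eq_matI)
  fix r s assume "r < dim_row (mat_delete A 0 0 * mat_delete B 0 0)"
    "s < dim_col (mat_delete A 0 0 * mat_delete B 0 0)"
  then have rs: "r < m" "s < m" using A B by (auto simp: mat_delete_def)
  have "mat_delete (A * B) 0 0 $$ (r, s) = (\<Sum>t\<in>{0..<Suc m}. A $$ (Suc r, t) * B $$ (t, Suc s))"
    using A B rs by (auto simp: mat_delete_def scalar_prod_def)
  also have "\<dots> = (\<Sum>t\<in>{0..<m}. A $$ (Suc r, Suc t) * B $$ (Suc t, Suc s))"
    using zero[of "Suc r"] rs by (subst sum.atLeast0_lessThan_Suc_shift) simp
  also have "\<dots> = (mat_delete A 0 0 * mat_delete B 0 0) $$ (r, s)"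
    using A B rs by (auto simp: mat_delete_def scalar_prod_def)
  finally show "mat_delete (A * B) 0 0 $$ (r, s) = (mat_delete A 0 0 * mat_delete B 0 0) $$ (r, s)" .
qed (use A B in \<open>auto simp: mat_delete_def\<close>)

theorem theorem2p7:
  fixes n i j :: nat and ms :: "'a::field multipoly list"
  assumes "n \<ge> 3"
    and "basis_enumeration n ms"
    and "i \<in> {1..n}" and "j \<in> {1..n}"
  shows "reduced_companion_matrix n ms i \<in> carrier_mat (c_dim n - 1) (c_dim n - 1)
    \<and> reduced_companion_matrix n ms j \<in> carrier_mat (c_dim n - 1) (c_dim n - 1)
    \<and> reduced_companion_matrix n ms i * reduced_companion_matrix n ms j
        - reduced_companion_matrix n ms j * reduced_companion_matrix n ms i
      = 0\<^sub>m (c_dim n - 1) (c_dim n - 1)"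
proof -
  have carr: "reduced_companion_matrix n ms k \<in> carrier_mat (c_dim n - 1) (c_dim n - 1)" for k
    unfolding reduced_companion_matrix_def by (rule mat_delete_carrier[OF companion_matrix_carrier])
  have Suc: "c_dim n = Suc (c_dim n - 1)" by (simp add: c_dim_def)
  have product: "mat_delete (companion_matrix n ms k * companion_matrix n ms l) 0 0
      = reduced_companion_matrix n ms k * reduced_companion_matrix n ms l" if "k \<in> {1..n}" for k l
    unfolding reduced_companion_matrix_def
    by (rule mat_delete_mult_first_column_zero[where m = "c_dim n - 1"])
      (use Suc companion_matrix_carrier companion_matrix_first_column[OF assms(1,2) that] in auto)
  have "reduced_companion_matrix n ms i * reduced_companion_matrix n ms j
      = reduced_companion_matrix n ms j * reduced_companion_matrix n ms i"
    using product[OF assms(3), of j] product[OF assms(4), of i]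
      companion_matrices_commute[OF assms] by simp
  then show ?thesis
    using carr[of i] carr[of j] by (simp add: minus_r_inv_mat[OF mult_carrier_mat])
qed

end
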